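(* Let $L$ be a cyclic Galois extension of $K$ of even degree $n=2m+2$ and suppose that $\sigma$ generates the Galois group $G$ of $L$ over $K$, so that the elements of $G$ are $1,\sigma,\sigma^{-1},\ldots,\sigma^m,\sigma^{-m},\sigma^{m+1}$. For $1\le i\le m+1$ let $A^i=\{f_{b,\sigma^i}: b\in L\}\subseteq\operatorname{Alt}(L)$. Then for any integer $k$ satisfying $1\le k\le m$, all non-zero elements of the $nk$-dimensional subspace $$A^1\oplus\cdots\oplus A^k$$ of $\operatorname{Alt}(L)$ have rank at least $n-2k$.
   Context: $L$ is regarded as an $n$-dimensional vector space over $K$. $\operatorname{Alt}(L)$ is the $K$-vector space of all alternating $K$-bilinear forms $L\times L\to K$ (bilinear $f$ with $f(x,x)=0$ for all $x$). $\operatorname{Tr}:L\to K$ is the trace, $\operatorname{Tr}(x)=\sum_{\tau\in G}\tau(x)$. For $b\in L$ and a non-identity $\tau\in G$, $f_{b,\tau}\in\operatorname{Alt}(L)$ is the form $f_{b,\tau}(x,y)=\operatorname{Tr}\big(b(x\tau(y)-\tau(x)y)\big)$. The rank of an alternating form $f$ is $n-\dim_K R$, where $R=\{x\in L: f(x,y)=0 \text{ for all } y\in L\}$ is its radical. *)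

theory Defs
  imports Complex_Main "HOL-Library.Function_Algebras" "HOL-Algebra.Generated_Groups"
begin

text \<open>
  An extension of a field \<open>K\<close> (the type \<open>'k\<close>) by a field \<open>L\<close> (the type \<open>'l\<close>) is given by a
  field homomorphism \<open>emb : K \<rightarrow> L\<close>; the copy of \<open>K\<close> inside \<open>L\<close> is \<^term>\<open>range emb\<close>.
\<close>

locale field_extension =
  fixes emb :: "'k::field \<Rightarrow> 'l::field"
  assumes emb_add: "emb (a + b) = emb a + emb b"
    and emb_mult: "emb (a * b) = emb a * emb b"
    and emb_one: "emb 1 = 1"

definition ext_scale :: "('k::field \<Rightarrow> 'l::field) \<Rightarrow> 'k \<Rightarrow> 'l \<Rightarrow> 'l" where
  "ext_scale emb a x = emb a * x"

text \<open>
  \<^const>\<open>vector_space.dim\<close> is \<open>0\<close> on infinite-dimensional spaces, so a positive degree is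
  necessarily the degree of a finite extension.
\<close>

definition ext_degree :: "('k::field \<Rightarrow> 'l::field) \<Rightarrow> nat" where
  "ext_degree emb = vector_space.dim (ext_scale emb) UNIV"

definition galois_group :: "('k::field \<Rightarrow> 'l::field) \<Rightarrow> ('l \<Rightarrow> 'l) monoid" where
  "galois_group emb =
     \<lparr>carrier = {\<tau>. bij \<tau> \<and> (\<forall>x y. \<tau> (x + y) = \<tau> x + \<tau> y) \<and>
                  (\<forall>x y. \<tau> (x * y) = \<tau> x * \<tau> y) \<and> (\<forall>a. \<tau> (emb a) = emb a)},
      mult = (\<circ>), one = id\<rparr>"

definition finite_galois :: "('k::field \<Rightarrow> 'l::field) \<Rightarrow> bool" where
  "finite_galois emb \<longleftrightarrow>
     field_extension emb \<and>
     (\<exists>B. finite B \<and> module.span (ext_scale emb) B = UNIV) \<and>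
     {x. \<forall>\<tau>\<in>carrier (galois_group emb). \<tau> x = x} = range emb"

text \<open>
  The sum of all conjugates lies in \<^term>\<open>range emb\<close> for a finite Galois extension;
  \<^term>\<open>the_inv emb\<close> reads it as an element of \<open>K\<close>.
\<close>

definition ext_trace :: "('k::field \<Rightarrow> 'l::field) \<Rightarrow> 'l \<Rightarrow> 'k" where
  "ext_trace emb x = the_inv emb (\<Sum>\<tau>\<in>carrier (galois_group emb). \<tau> x)"

definition form_scale :: "'k::field \<Rightarrow> ('l \<Rightarrow> 'l \<Rightarrow> 'k) \<Rightarrow> 'l \<Rightarrow> 'l \<Rightarrow> 'k" where
  "form_scale c f = (\<lambda>x y. c * f x y)"

definition Alt :: "('k::field \<Rightarrow> 'l::field) \<Rightarrow> ('l \<Rightarrow> 'l \<Rightarrow> 'k) set" where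
  "Alt emb =
     {f. (\<forall>y. Vector_Spaces.linear (ext_scale emb) (*) (\<lambda>x. f x y)) \<and>
         (\<forall>x. Vector_Spaces.linear (ext_scale emb) (*) (\<lambda>y. f x y)) \<and>
         (\<forall>x. f x x = 0)}"

definition trace_form ::
  "('k::field \<Rightarrow> 'l::field) \<Rightarrow> 'l \<Rightarrow> ('l \<Rightarrow> 'l) \<Rightarrow> 'l \<Rightarrow> 'l \<Rightarrow> 'k" where
  "trace_form emb b \<tau> x y = ext_trace emb (b * (x * \<tau> y - \<tau> x * y))"

definition trace_form_space ::
  "('k::field \<Rightarrow> 'l::field) \<Rightarrow> ('l \<Rightarrow> 'l) \<Rightarrow> ('l \<Rightarrow> 'l \<Rightarrow> 'k) set" where
  "trace_form_space emb \<tau> = {trace_form emb b \<tau> |b. True}"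

definition radical :: "('l \<Rightarrow> 'l \<Rightarrow> 'k::field) \<Rightarrow> 'l set" where
  "radical f = {x. \<forall>y. f x y = 0}"

definition form_rank :: "('k::field \<Rightarrow> 'l::field) \<Rightarrow> ('l \<Rightarrow> 'l \<Rightarrow> 'k) \<Rightarrow> nat" where
  "form_rank emb f = ext_degree emb - vector_space.dim (ext_scale emb) (radical f)"

definition family_sum :: "'i set \<Rightarrow> ('i \<Rightarrow> 'v::ab_group_add set) \<Rightarrow> 'v set" where
  "family_sum I A = {(\<Sum>i\<in>I. g i) |g. \<forall>i\<in>I. g i \<in> A i}"

definition sum_is_direct :: "'i set \<Rightarrow> ('i \<Rightarrow> 'v::ab_group_add set) \<Rightarrow> bool" where
  "sum_is_direct I A \<longleftrightarrow>
     (\<forall>g. (\<forall>i\<in>I. g i \<in> A i) \<and> (\<Sum>i\<in>I. g i) = 0 \<longrightarrow> (\<forall>i\<in>I. g i = 0))"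

lemma (in field_extension) vector_space_ext_scale: "vector_space (ext_scale emb)"
  by unfold_locales (auto simp: ext_scale_def emb_add emb_mult emb_one algebra_simps)

lemma (in field_extension) inj_emb: "inj emb"
proof (rule injI)
  fix a b assume eq: "emb a = emb b"
  have "emb (a - b) = 0"
    using emb_add[of "a - b" b] eq by simp
  then have "a - b = 0"
    using emb_mult[of "a - b" "inverse (a - b)"] emb_one by (cases "a - b = 0") auto
  then show "a = b" by simp
qed

lemma vector_space_form_scale:
  "vector_space (form_scale :: 'k::field \<Rightarrow> ('l \<Rightarrow> 'l \<Rightarrow> 'k) \<Rightarrow> _)"
  by unfold_locales (auto simp: form_scale_def fun_eq_iff algebra_simps)

lemma group_galois_group: "group (galois_group emb)"
proof (rule groupI)
  fix \<tau> assume t: "\<tau> \<in> carrier (galois_group emb)"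
  then have b: "bij \<tau>" by (simp add: galois_group_def)
  have s: "\<tau> (inv_into UNIV \<tau> z) = z" "inv_into UNIV \<tau> (\<tau> z) = z" for z
    using b by (simp_all add: bij_is_surj surj_f_inv_f bij_is_inj)
  have h: "\<tau> (x + y) = \<tau> x + \<tau> y" "\<tau> (x * y) = \<tau> x * \<tau> y" "\<tau> (emb a) = emb a" for x y a
    using t by (auto simp: galois_group_def)
  have "inv_into UNIV \<tau> (x + y) = inv_into UNIV \<tau> x + inv_into UNIV \<tau> y" for x y
    using h(1)[of "inv_into UNIV \<tau> x" "inv_into UNIV \<tau> y"] s by metis
  moreover have "inv_into UNIV \<tau> (x * y) = inv_into UNIV \<tau> x * inv_into UNIV \<tau> y" for x y
    using h(2)[of "inv_into UNIV \<tau> x" "inv_into UNIV \<tau> y"] s by metis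
  moreover have "inv_into UNIV \<tau> (emb a) = emb a" for a
    using h(3)[of a] s by metis
  ultimately have "inv_into UNIV \<tau> \<in> carrier (galois_group emb)"
    using b by (simp add: galois_group_def bij_imp_bij_inv)
  moreover have "inv_into UNIV \<tau> \<circ> \<tau> = id"
    using s by auto
  ultimately show "\<exists>y\<in>carrier (galois_group emb).
      y \<otimes>\<^bsub>galois_group emb\<^esub> \<tau> = \<one>\<^bsub>galois_group emb\<^esub>"
    by (auto simp: galois_group_def)
qed (auto simp: galois_group_def bij_comp comp_assoc)

lemma (in field_extension) subspace_Alt: "module.subspace form_scale (Alt emb)"
proof -
  interpret F: vector_space "form_scale :: 'k \<Rightarrow> ('l \<Rightarrow> 'l \<Rightarrow> 'k) \<Rightarrow> _"
    by (rule vector_space_form_scale)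
  interpret E: vector_space "ext_scale emb" by (rule vector_space_ext_scale)
  interpret M: vector_space "(*) :: 'k \<Rightarrow> 'k \<Rightarrow> 'k"
    by unfold_locales (auto simp: algebra_simps)
  have lin: "Vector_Spaces.linear (ext_scale emb) (*) g \<longleftrightarrow>
      (\<forall>x y. g (x + y) = g x + g y) \<and> (\<forall>c x. g (ext_scale emb c x) = c * g x)"
    for g :: "'l \<Rightarrow> 'k"
    using E.vector_space_axioms M.vector_space_axioms E.module_axioms M.module_axioms
    by (simp only: Vector_Spaces.linear_def module_hom_def module_hom_axioms_def simp_thms)
  show ?thesis
  proof (rule F.subspaceI)
    show "0 \<in> Alt emb"
      by (simp add: Alt_def lin)
    show "f + g \<in> Alt emb" if "f \<in> Alt emb" "g \<in> Alt emb" for f g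
      using that by (simp add: Alt_def lin distrib_left add_ac)
    show "form_scale c f \<in> Alt emb" if "f \<in> Alt emb" for c f
      using that by (simp add: Alt_def lin form_scale_def distrib_left mult.left_commute)
  qed
qed

end

theory Submission
  imports Defs
begin

text \<open>
  A skew polynomial \<open>\<Sum>\<^sub>j a\<^sub>j \<sigma>\<^sup>j\<close> of degree \<open>d\<close> with a non-zero coefficient has a kernel of
  dimension at most \<open>d\<close> over the fixed field \<open>K\<close> of \<open>\<sigma>\<close>. Since some monic skew polynomial of
  degree \<open>n\<close> kills \<open>L\<close>, this bound forces \<open>\<sigma>\<close> to have order exactly \<open>n\<close>, and it makes the
  trace (of degree \<open>n - 1\<close>) non-zero. Up to powers of \<open>\<sigma>\<close>, the radical of a form in
  \<open>A\<^sup>1 + \<dots> + A\<^sup>k\<close> is the kernel of a skew polynomial of degree at most \<open>2k < n\<close>. Unless all its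
  coefficients vanish, the radical has dimension at most \<open>2k\<close>; this gives the rank bound,
  and also the directness of the sum, because the radical of \<open>0\<close> is \<open>L\<close>.
\<close>

section \<open>Linear algebra of sums of subspaces and of indexed independent families\<close>

lemma sum_apply: "(\<Sum>i\<in>I. f i) x = (\<Sum>i\<in>I. f i x)"
  for f :: "'i \<Rightarrow> 'a \<Rightarrow> 'b::comm_monoid_add"
  by (induction I rule: infinite_finite_induct) auto

lemma (in module) subspace_family_sum:
  assumes "\<And>i. i \<in> I \<Longrightarrow> subspace (A i)"
  shows "subspace (family_sum I A)"
proof (rule subspaceI)
  show "0 \<in> family_sum I A"
    unfolding family_sum_def using assms subspace_0 by (auto intro!: exI[of _ "\<lambda>_. 0"])
next
  fix x y assume "x \<in> family_sum I A" "y \<in> family_sum I A"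
  then obtain g h where "x = sum g I" "y = sum h I" "\<forall>i\<in>I. g i \<in> A i" "\<forall>i\<in>I. h i \<in> A i"
    unfolding family_sum_def by auto
  then show "x + y \<in> family_sum I A"
    unfolding family_sum_def using assms subspace_add
    by (auto intro!: exI[of _ "\<lambda>i. g i + h i"] simp: sum.distrib)
next
  fix c x assume "x \<in> family_sum I A"
  then obtain g where "x = sum g I" "\<forall>i\<in>I. g i \<in> A i"
    unfolding family_sum_def by auto
  then show "c *s x \<in> family_sum I A"
    unfolding family_sum_def using assms subspace_scale
    by (auto intro!: exI[of _ "\<lambda>i. c *s g i"] simp: scale_sum_right)
qed

text \<open>Phrased for an indexed family, since a dimension count by \<open>card I\<close> also
  needs distinct indices to give distinct vectors.\<close>

lemma (in vector_space) independent_family: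
  assumes "finite I"
    and zero: "\<And>c. (\<Sum>i\<in>I. c i *s g i) = 0 \<Longrightarrow> \<forall>i\<in>I. c i = 0"
  shows "inj_on g I" and "independent (g ` I)"
proof -
  show inj: "inj_on g I"
  proof (rule inj_onI, rule ccontr)
    fix i j assume ij: "i \<in> I" "j \<in> I" "g i = g j" "i \<noteq> j"
    \<comment> \<open>Two indices sharing a vector would make the difference of their indicators a
      nontrivial relation.\<close>
    let ?c = "\<lambda>l. (if l = i then 1 else 0 :: 'a) - (if l = j then 1 else 0)"
    have "(\<Sum>l\<in>I. ?c l *s g l)
      = (\<Sum>l\<in>I. if l = i then g l else 0) - (\<Sum>l\<in>I. if l = j then g l else 0)"
      by (subst sum_subtractf[symmetric], rule sum.cong) (auto simp: scale_left_diff_distrib)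
    also have "\<dots> = 0"
      using ij \<open>finite I\<close> by simp
    finally have "?c i = 0"
      using zero[of ?c] ij(1) by blast
    then show False using ij by simp
  qed
  show "independent (g ` I)"
  proof (rule independent_if_scalars_zero)
    fix f x assume f: "(\<Sum>x\<in>g ` I. f x *s x) = 0" and "x \<in> g ` I"
    then show "f x = 0"
      using zero[of "\<lambda>i. f (g i)"] by (auto simp: sum.reindex[OF inj])
  qed (use \<open>finite I\<close> in simp)
qed

section \<open>The cyclic extension and the powers of its generator\<close>

locale cyclic_galois_extension = field_extension emb
  for emb :: "'k::field \<Rightarrow> 'l::field" +
  fixes \<sigma> :: "'l \<Rightarrow> 'l"
  assumes galois: "finite_galois emb"
    and sigma_carrier: "\<sigma> \<in> carrier (galois_group emb)"
    and cyclic: "carrier (galois_group emb) = generate (galois_group emb) {\<sigma>}"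
    and degree_pos: "ext_degree emb > 0"
begin

sublocale E: vector_space "ext_scale emb"
  by (rule vector_space_ext_scale)

abbreviation n where "n \<equiv> ext_degree emb"

lemma sigma_bij: "bij \<sigma>"
  and sigma_add: "\<sigma> (x + y) = \<sigma> x + \<sigma> y"
  and sigma_mult: "\<sigma> (x * y) = \<sigma> x * \<sigma> y"
  and sigma_emb: "\<sigma> (emb a) = emb a"
  using sigma_carrier by (auto simp: galois_group_def)

lemma pow_add: "(\<sigma> ^^ j) (x + y) = (\<sigma> ^^ j) x + (\<sigma> ^^ j) y"
  by (induction j) (auto simp: sigma_add)

lemma pow_mult: "(\<sigma> ^^ j) (x * y) = (\<sigma> ^^ j) x * (\<sigma> ^^ j) y"
  by (induction j) (auto simp: sigma_mult)

lemma pow_emb: "(\<sigma> ^^ j) (emb a) = emb a"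
  by (induction j) (auto simp: sigma_emb)

lemma pow_bij: "bij (\<sigma> ^^ j)"
  using sigma_bij by (rule bij_fn)

lemma pow_0: "(\<sigma> ^^ j) 0 = 0"
  using pow_add[of j 0 0] by (metis add.right_neutral add_cancel_right_right)

lemma pow_1: "(\<sigma> ^^ j) 1 = 1"
  using pow_emb[of j 1] by (simp add: emb_one)

lemma pow_eq_0_iff: "(\<sigma> ^^ j) x = 0 \<longleftrightarrow> x = 0"
  using pow_bij[of j] pow_0[of j] by (metis bij_pointE)

lemma pow_diff: "(\<sigma> ^^ j) (x - y) = (\<sigma> ^^ j) x - (\<sigma> ^^ j) y"
  using pow_add[of j "x - y" y] by (simp add: algebra_simps)

lemma pow_sum: "(\<sigma> ^^ j) (\<Sum>i\<in>I. f i) = (\<Sum>i\<in>I. (\<sigma> ^^ j) (f i))"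
  by (induction I rule: infinite_finite_induct) (auto simp: pow_add pow_0)

lemma sigma_0: "\<sigma> 0 = 0"
  and sigma_sum: "\<sigma> (\<Sum>i\<in>I. f i) = (\<Sum>i\<in>I. \<sigma> (f i))"
  using pow_0[of 1] pow_sum[of 1] by auto

text \<open>What \<sigma> fixes is fixed by everything it generates, and the Galois condition says
  that the common fixed field is K.\<close>

lemma fixed_by_sigma:
  assumes "\<sigma> x = x"
  shows "x \<in> range emb"
proof -
  interpret G: group "galois_group emb" by (rule group_galois_group)
  have "\<tau> x = x" if "\<tau> \<in> generate (galois_group emb) {\<sigma>}" for \<tau>
    using that
  proof induction
    case (inv h)
    then have "(inv\<^bsub>galois_group emb\<^esub> \<sigma>) \<circ> \<sigma> = id"
      using G.l_inv[OF sigma_carrier] by (simp add: galois_group_def)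
    then show ?case
      using inv assms by (metis comp_apply id_apply singletonD)
  qed (use assms in \<open>auto simp: galois_group_def\<close>)
  then show ?thesis
    using galois cyclic unfolding finite_galois_def by auto
qed

lemma basis_exists_degree:
  obtains B where "finite B" "card B = n" "E.independent B" "E.span B = UNIV"
proof -
  obtain B where B: "B \<subseteq> UNIV" "E.independent B" "UNIV \<subseteq> E.span B" "card B = E.dim UNIV"
    by (rule E.basis_exists)
  then have "card B = n"
    by (simp add: ext_degree_def)
  \<comment> \<open>An infinite set has \<open>card\<close> equal to 0, so positivity of the degree
    forces finiteness.\<close>
  moreover from this degree_pos have "finite B"
    by (metis card.infinite less_irrefl)
  ultimately show ?thesis
    using B that by blast
qed

subsection \<open>Skew polynomials in the generator\<close>

text \<open>Here \<open>d\<close> only bounds the degree: \<open>a d\<close> may be 0, and values of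
  \<open>a\<close> beyond \<open>d\<close> are ignored. Being non-zero is therefore expressed by
  \<open>\<exists>j\<le>d. a j \<noteq> 0\<close>.\<close>

definition skew :: "(nat \<Rightarrow> 'l) \<Rightarrow> nat \<Rightarrow> 'l \<Rightarrow> 'l" where
  "skew a d x = (\<Sum>j\<le>d. a j * (\<sigma> ^^ j) x)"

lemma subspace_skew_kernel: "E.subspace {x. skew a d x = 0}"
proof (rule E.subspaceI)
  show "0 \<in> {x. skew a d x = 0}"
    by (simp add: skew_def pow_0)
  show "x + y \<in> {x. skew a d x = 0}"
    if "x \<in> {x. skew a d x = 0}" "y \<in> {x. skew a d x = 0}" for x y
    using that by (simp add: skew_def pow_add distrib_left sum.distrib)
  show "ext_scale emb c x \<in> {x. skew a d x = 0}" if "x \<in> {x. skew a d x = 0}" for c x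
  proof -
    have "skew a d (ext_scale emb c x) = emb c * skew a d x"
      by (simp add: skew_def ext_scale_def pow_mult pow_emb sum_distrib_left mult.left_commute)
    with that show ?thesis by simp
  qed
qed

text \<open>
  Rescaling by a kernel element \<open>u\<close> reduces to the case that \<open>1\<close> is in the kernel; then the
  coefficients sum to \<open>0\<close>, and summation by parts splits off a right factor \<open>\<sigma> - 1\<close>, whose
  kernel is \<open>K\<close>.
\<close>

lemma card_independent_skew_kernel:
  assumes "E.independent B" and "\<And>x. x \<in> B \<Longrightarrow> skew a d x = 0"
    and "\<exists>j\<le>d. a j \<noteq> 0"
  shows "card B \<le> d"
  using assms
proof (induction d arbitrary: a B)
  case 0
  have "B = {}"
  proof (rule ccontr)
    assume "B \<noteq> {}"
    then obtain u where "u \<in> B" by blast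
    then have "u = 0"
      using 0 by (auto simp: skew_def)
    with \<open>u \<in> B\<close> show False
      using 0 E.dependent_zero by blast
  qed
  then show ?case by simp
next
  case (Suc d)
  show ?case
  proof (cases "B = {} \<or> infinite B")
    case False
    then obtain u where u: "u \<in> B" by blast
    have u0: "u \<noteq> 0"
      using u Suc E.dependent_zero by blast
    \<comment> \<open>Let P be the given operator. Then \<open>a'\<close> has the coefficients of P
      after multiplication by \<open>u\<close>, \<open>f\<close> is \<sigma> - 1 after division by
      \<open>u\<close>, and \<open>q\<close> has the coefficients of the Q with P = Q f.\<close>
    define a' where "a' j = a j * (\<sigma> ^^ j) u" for j
    define q where "q j = - (\<Sum>i\<le>j. a' i)" for j
    define f where "f y = \<sigma> (y / u) - y / u" for y
    have a'_sum: "(\<Sum>i\<le>Suc d. a' i) = 0"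
      using Suc.prems(2)[OF u] by (simp add: skew_def a'_def)
    have by_parts: "(\<Sum>j\<le>e. q j * (\<sigma> ^^ j) (\<sigma> y - y))
        = (\<Sum>j\<le>e. a' j * (\<sigma> ^^ j) y) + q e * (\<sigma> ^^ Suc e) y" for e y
    proof (induction e)
      case (Suc e)
      have q_e: "q e = q (Suc e) + a' (Suc e)"
        by (simp add: q_def)
      have pow_Suc: "(\<sigma> ^^ Suc e) (\<sigma> y - y) = (\<sigma> ^^ Suc (Suc e)) y - (\<sigma> ^^ Suc e) y"
        unfolding pow_diff by (simp only: funpow_Suc_right comp_apply)
      have cancel: "s + (r + c) * z + r * (z' - z) = s + c * z + r * z'" for s r c z z' :: 'l
        by (simp add: algebra_simps)
      show ?case
        unfolding sum.atMost_Suc Suc.IH pow_Suc q_e by (rule cancel)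
    qed (simp add: q_def algebra_simps)
    \<comment> \<open>Because the \<open>a'\<close> sum to 0, the boundary term of the summation by
      parts is exactly the missing top term.\<close>
    have q_d: "q d = a' (Suc d)"
      using a'_sum by (simp add: q_def minus_equation_iff add_eq_0_iff)
    have q_eval: "skew q d (\<sigma> y - y) = (\<Sum>j\<le>Suc d. a' j * (\<sigma> ^^ j) y)" for y
      using by_parts[where e=d and y=y] by (simp add: skew_def q_d)
    have ker_q: "skew q d (f b) = skew a (Suc d) b" for b
    proof -
      have "a' j * (\<sigma> ^^ j) (b / u) = a j * (\<sigma> ^^ j) b" for j
        using pow_mult[of j u "b / u"] u0 by (simp add: a'_def mult.assoc)
      then show ?thesis
        unfolding f_def q_eval by (simp add: skew_def)
    qed
    \<comment> \<open>Up to sign, the \<open>a'\<close> are the differences of neighbouring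
      \<open>q\<close>, and \<open>q d\<close> is the top one, so Q = 0 would force P = 0.\<close>
    have q_nz: "\<exists>j\<le>d. q j \<noteq> 0"
    proof (rule ccontr)
      assume "\<not> ?thesis"
      then have q0: "q j = 0" if "j \<le> d" for j using that by blast
      have "a' j = 0" if "j \<le> Suc d" for j
      proof (cases j)
        case 0
        then show ?thesis using q0[of 0] by (simp add: q_def)
      next
        case (Suc i)
        show ?thesis
        proof (cases "i = d")
          case True
          then show ?thesis using Suc q_d q0[of d] by simp
        next
          case False
          then have "q i = 0" "q (Suc i) = 0" using q0 that Suc by auto
          then show ?thesis using Suc by (simp add: q_def)
        qed
      qed
      then show False
        using Suc.prems(3) u0 by (auto simp: a'_def pow_eq_0_iff)
    qed
    interpret VP: vector_space_pair "ext_scale emb" "ext_scale emb" ..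
    have f_add: "f (x + y) = f x + f y" for x y
      unfolding f_def add_divide_distrib sigma_add by simp
    have f_scale: "f (ext_scale emb c x) = ext_scale emb c (f x)" for c x
    proof -
      have "ext_scale emb c x / u = emb c * (x / u)"
        by (simp add: ext_scale_def)
      then show ?thesis
        unfolding f_def ext_scale_def sigma_mult right_diff_distrib by (simp only: sigma_mult sigma_emb)
    qed
    have lin: "Vector_Spaces.linear (ext_scale emb) (ext_scale emb) f"
      by unfold_locales (fact f_add f_scale)+
    have f_ker: "x \<in> E.span {u}" if "f x = 0" for x
    proof -
      have "x / u \<in> range emb"
        using that by (intro fixed_by_sigma) (simp add: f_def)
      then obtain c where "x / u = emb c" by blast
      then have "x = ext_scale emb c u"
        using u0 by (simp add: ext_scale_def field_simps)
      then show ?thesis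
        by (simp add: E.span_base E.span_scale)
    qed
    have u_notin: "u \<notin> E.span (B - {u})"
      using Suc.prems(1) u E.dependent_def by blast
    \<comment> \<open>The kernel of \<open>f\<close> lies in the line through \<open>u\<close>,
      which meets the span of the other elements only in 0.\<close>
    have inj: "inj_on f (E.span (B - {u}))"
    proof (rule inj_onI)
      fix x y assume xy: "x \<in> E.span (B - {u})" "y \<in> E.span (B - {u})" "f x = f y"
      then have "f (x - y) = 0"
        using f_add[of "x - y" y] by simp
      then obtain c where c: "x - y = ext_scale emb c u"
        using f_ker by (auto simp: E.span_singleton)
      have "x - y \<in> E.span (B - {u})"
        using xy E.span_diff by blast
      have "c = 0"
      proof (rule ccontr)
        assume "c \<noteq> 0"
        then have "ext_scale emb (inverse c) (x - y) = u"
          by (simp add: c)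
        then show False
          using E.span_scale[OF \<open>x - y \<in> E.span (B - {u})\<close>, of "inverse c"] u_notin by simp
      qed
      then show "x = y"
        using c by simp
    qed
    have "E.independent (B - {u})"
      using Suc.prems(1) E.independent_mono by blast
    then have "E.independent (f ` (B - {u}))"
      using VP.linear_independent_injective_image[OF lin _ inj] by blast
    moreover have "skew q d x = 0" if "x \<in> f ` (B - {u})" for x
      using that Suc.prems(2) by (auto simp: ker_q)
    ultimately have "card (f ` (B - {u})) \<le> d"
      using q_nz by (intro Suc.IH)
    moreover have "card (f ` (B - {u})) = card (B - {u})"
      by (rule card_image[OF inj_on_subset[OF inj E.span_superset]])
    ultimately show ?thesis
      using u False by simp
  qed auto
qed

text \<open>A basis of L has n > d elements, too many for all of them to lie in the kernel.\<close>

lemma skew_nonzero: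
  assumes "d < n" and "\<exists>j\<le>d. a j \<noteq> 0"
  obtains x where "skew a d x \<noteq> 0"
proof -
  obtain B where B: "finite B" "card B = n" "E.independent B" "E.span B = UNIV"
    by (rule basis_exists_degree)
  then have "\<exists>x\<in>B. skew a d x \<noteq> 0"
    using card_independent_skew_kernel[OF B(3) _ assms(2)] assms(1) B(2) by fastforce
  then show ?thesis
    using that by blast
qed

text \<open>
  The witness for \<open>insert u B\<close> is \<open>(\<sigma> - \<sigma> w / w) P\<close> where \<open>P\<close> kills \<open>B\<close> and \<open>w = P u\<close>;
  if \<open>w = 0\<close>, then \<open>\<sigma> w / w = 0\<close> and \<open>\<sigma> P\<close> works as well.
\<close>

lemma monic_skew_vanishing:
  assumes "finite B"
  shows "\<exists>a. a (card B) = 1 \<and> (\<forall>x\<in>B. skew a (card B) x = 0)"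
  using assms
proof induction
  case empty
  then show ?case by (auto intro: exI[of _ "\<lambda>_. 1"])
next
  case (insert u B)
  then obtain a where a: "a (card B) = 1" "\<forall>x\<in>B. skew a (card B) x = 0" by blast
  define d where "d = card B"
  define c where "c = \<sigma> (skew a d u) / skew a d u"
  \<comment> \<open>\<open>s\<close> lists the coefficients of \<sigma> P, shifted by one degree,
    and \<open>a'\<close> those of (\<sigma> - c) P.\<close>
  define s where "s j = (case j of 0 \<Rightarrow> 0 | Suc i \<Rightarrow> \<sigma> (a i))" for j
  define a' where "a' j = s j - (if j \<le> d then c * a j else 0)" for j
  have "skew a' (Suc d) x = \<sigma> (skew a d x) - c * skew a d x" for x
  proof -
    have "skew a' (Suc d) x = (\<Sum>j\<le>Suc d. s j * (\<sigma> ^^ j) x)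
        - (\<Sum>j\<le>Suc d. (if j \<le> d then c * a j else 0) * (\<sigma> ^^ j) x)"
      by (simp add: skew_def a'_def left_diff_distrib sum_subtractf)
    also have "(\<Sum>j\<le>Suc d. s j * (\<sigma> ^^ j) x) = \<sigma> (skew a d x)"
      by (subst sum.atMost_Suc_shift) (simp add: s_def skew_def sigma_sum sigma_mult)
    also have "(\<Sum>j\<le>Suc d. (if j \<le> d then c * a j else 0) * (\<sigma> ^^ j) x) = c * skew a d x"
      by (simp add: skew_def sum_distrib_left mult.assoc)
    finally show ?thesis .
  qed
  then have "skew a' (Suc d) x = 0" if "x \<in> insert u B" for x
    using that a by (auto simp: c_def d_def sigma_0)
  moreover have "a' (Suc d) = 1"
    using a pow_1[of 1] by (simp add: a'_def s_def d_def)
  ultimately show ?case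
    using insert by (intro exI[of _ a']) (simp add: d_def)
qed

subsection \<open>The order of the generator and the trace\<close>

text \<open>Otherwise \<open>\<sigma> ^^ N\<close> - 1 would be a non-zero skew polynomial of degree
  N < n killing L.\<close>

lemma degree_le_period:
  assumes "\<sigma> ^^ N = id" and "N > 0"
  shows "n \<le> N"
proof (rule ccontr)
  assume "\<not> n \<le> N"
  define a where "a j = (if j = N then 1 else if j = 0 then - 1 else 0 :: 'l)" for j
  have "\<exists>j\<le>N. a j \<noteq> 0"
    by (auto simp: a_def)
  then obtain x where "skew a N x \<noteq> 0"
    using skew_nonzero[of N a] \<open>\<not> n \<le> N\<close> by auto
  moreover have "skew a N x = 0"
  proof -
    obtain M where M: "N = Suc M" using \<open>N > 0\<close> gr0_conv_Suc by blast
    have "skew a N x = a N * (\<sigma> ^^ N) x + (\<Sum>j\<le>M. a j * (\<sigma> ^^ j) x)"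
      by (simp add: skew_def M)
    also have "(\<Sum>j\<le>M. a j * (\<sigma> ^^ j) x) = (\<Sum>j\<le>M. if j = 0 then - x else 0)"
      by (rule sum.cong) (auto simp: a_def M)
    also have "a N * (\<sigma> ^^ N) x + \<dots> = 0"
      using assms by (simp add: a_def)
    finally show ?thesis .
  qed
  ultimately show False by simp
qed

text \<open>
  For a monic \<open>P\<close> of degree \<open>n\<close> killing \<open>L\<close>, the operator \<open>P c - \<sigma>\<^sup>n(c) P\<close> also kills \<open>L\<close>
  and has smaller degree, so its coefficients vanish.
\<close>

lemma sigma_pow_degree: "\<sigma> ^^ n = id"
proof -
  obtain B where B: "finite B" "card B = n" "E.independent B" "E.span B = UNIV"
    by (rule basis_exists_degree)
  obtain a where a: "a n = 1" "\<forall>x\<in>B. skew a n x = 0"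
    using monic_skew_vanishing[OF B(1)] B(2) by auto
  have van: "skew a n x = 0" for x
    using E.span_minimal[OF _ subspace_skew_kernel, of B a n] a B by blast
  obtain d where d: "n = Suc d"
    using degree_pos gr0_conv_Suc by blast
  have coeff: "a j * ((\<sigma> ^^ j) c - (\<sigma> ^^ n) c) = 0" if "j \<le> d" for j c
  proof (rule ccontr)
    define b where "b j = a j * ((\<sigma> ^^ j) c - (\<sigma> ^^ n) c)" for j
    assume "a j * ((\<sigma> ^^ j) c - (\<sigma> ^^ n) c) \<noteq> 0"
    then have "b j \<noteq> 0"
      by (simp add: b_def)
    then obtain x where "skew b d x \<noteq> 0"
      using skew_nonzero[of d b] \<open>j \<le> d\<close> d by auto
    moreover have "skew b n x = skew a n (c * x) - (\<sigma> ^^ n) c * skew a n x"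
      unfolding skew_def b_def sum_distrib_left sum_subtractf[symmetric]
      by (rule sum.cong) (simp_all add: pow_mult algebra_simps)
    moreover have "skew b n x = skew b d x"
      by (simp add: skew_def d b_def)
    ultimately show False
      by (simp add: van)
  qed
  \<comment> \<open>Otherwise the operator would be \<open>\<sigma> ^^ n\<close> alone, which takes
    the value 1 at 1.\<close>
  obtain j where j: "j \<le> d" "a j \<noteq> 0"
  proof (rule ccontr)
    assume "\<not> thesis"
    with that have "a j = 0" if "j \<le> d" for j using \<open>j \<le> d\<close> by blast
    then have "skew a n 1 = a n"
      by (simp add: skew_def d pow_1 del: funpow.simps)
    then show False
      using van a by simp
  qed
  \<comment> \<open>As \<open>a j\<close> is non-zero, \<open>\<sigma> ^^ j\<close> and
    \<open>\<sigma> ^^ n\<close> agree. Cancelling \<open>\<sigma> ^^ j\<close> gives the period n -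
    j, and no positive period is below n, so j = 0.\<close>
  have "(\<sigma> ^^ j) ((\<sigma> ^^ (n - j)) c) = (\<sigma> ^^ j) c" for c
  proof -
    have "(\<sigma> ^^ j) ((\<sigma> ^^ (n - j)) c) = (\<sigma> ^^ n) c"
      using j d by (metis comp_apply funpow_add le_add_diff_inverse le_SucI)
    then show ?thesis
      using coeff[OF j(1), of c] j(2) by simp
  qed
  then have "\<sigma> ^^ (n - j) = id"
    using pow_bij[of j] by (intro ext) (metis bij_is_inj id_apply injD)
  moreover from this have "n \<le> n - j"
    using degree_le_period j d by simp
  ultimately show ?thesis
    by (metis diff_le_self le_antisym)
qed

text \<open>Since \<open>\<sigma> ^^ n = id\<close>, exponents reduce modulo n and
  \<open>\<sigma> ^^ (n - 1)\<close> is the inverse of \<sigma>.\<close>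

lemma carrier_eq: "carrier (galois_group emb) = (\<lambda>j. \<sigma> ^^ j) ` {..<n}"
proof
  interpret G: group "galois_group emb" by (rule group_galois_group)
  have mod_n: "\<sigma> ^^ j \<in> (\<lambda>j. \<sigma> ^^ j) ` {..<n}" for j
  proof -
    have "\<sigma> ^^ j = \<sigma> ^^ (j mod n)"
      by (rule ext) (simp add: funpow_mod_eq sigma_pow_degree)
    then show ?thesis
      using degree_pos by auto
  qed
  have pow_carrier: "\<sigma> ^^ j \<in> carrier (galois_group emb)" for j
    by (auto simp: galois_group_def pow_bij pow_add pow_mult pow_emb)
  then show "(\<lambda>j. \<sigma> ^^ j) ` {..<n} \<subseteq> carrier (galois_group emb)"
    by blast
  have "\<tau> \<in> (\<lambda>j. \<sigma> ^^ j) ` {..<n}" if "\<tau> \<in> generate (galois_group emb) {\<sigma>}" for \<tau>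
    using that
  proof induction
    case one
    then show ?case
      using mod_n[of 0] by (simp add: galois_group_def id_def)
  next
    case (incl h)
    then show ?case
      using mod_n[of 1] by simp
  next
    case (inv h)
    have "(\<sigma> ^^ (n - 1)) \<circ> \<sigma> = id"
      using sigma_pow_degree degree_pos by (metis Suc_diff_1 funpow_Suc_right)
    then have "inv\<^bsub>galois_group emb\<^esub> \<sigma> = \<sigma> ^^ (n - 1)"
      using sigma_carrier pow_carrier by (intro G.inv_equality) (auto simp: galois_group_def)
    then show ?case
      using inv mod_n by simp
  next
    case (eng h1 h2)
    then obtain i j where "h1 = \<sigma> ^^ i" "h2 = \<sigma> ^^ j"
      by blast
    then have "h1 \<otimes>\<^bsub>galois_group emb\<^esub> h2 = \<sigma> ^^ (i + j)"
      by (simp add: galois_group_def funpow_add)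
    then show ?case
      using mod_n by simp
  qed
  then show "carrier (galois_group emb) \<subseteq> (\<lambda>j. \<sigma> ^^ j) ` {..<n}"
    using cyclic by blast
qed

text \<open>Two equal powers would yield a positive period below n.\<close>

lemma inj_on_pow: "inj_on (\<lambda>j. \<sigma> ^^ j) {..<n}"
proof (rule linorder_inj_onI')
  fix i j assume ij: "i \<in> {..<n}" "j \<in> {..<n}" "i < j"
  show "\<sigma> ^^ i \<noteq> \<sigma> ^^ j"
  proof
    assume eq: "\<sigma> ^^ i = \<sigma> ^^ j"
    have "(\<sigma> ^^ i) ((\<sigma> ^^ (j - i)) x) = (\<sigma> ^^ i) x" for x
      using ij eq by (metis comp_apply funpow_add le_add_diff_inverse less_imp_le)
    then have "\<sigma> ^^ (j - i) = id"
      using pow_bij[of i] by (intro ext) (metis bij_is_inj id_apply injD)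
    then show False
      using degree_le_period[of "j - i"] ij by simp
  qed
qed

text \<open>Applying \<sigma> permutes the summands cyclically, so the sum lies in K, where
  \<open>the_inv emb\<close> inverts \<open>emb\<close>.\<close>

lemma emb_trace: "emb (ext_trace emb x) = (\<Sum>j<n. (\<sigma> ^^ j) x)"
proof -
  have "\<sigma> (\<Sum>j<n. (\<sigma> ^^ j) x) + x = (\<Sum>j<Suc n. (\<sigma> ^^ j) x)"
    by (subst sum.lessThan_Suc_shift) (simp add: sigma_sum add.commute)
  then have "\<sigma> (\<Sum>j<n. (\<sigma> ^^ j) x) = (\<Sum>j<n. (\<sigma> ^^ j) x)"
    using sigma_pow_degree by simp
  then have "(\<Sum>j<n. (\<sigma> ^^ j) x) \<in> range emb"
    by (rule fixed_by_sigma)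
  then show ?thesis
    using inj_emb by (simp add: ext_trace_def carrier_eq sum.reindex[OF inj_on_pow] f_the_inv_into_f)
qed

lemma emb_0: "emb 0 = 0"
  using emb_add[of 0 0] by (metis add.right_neutral add_cancel_right_right)

lemma trace_add: "ext_trace emb (x + y) = ext_trace emb x + ext_trace emb y"
  by (rule inj_emb[THEN injD]) (simp add: emb_trace emb_add pow_add sum.distrib)

lemma trace_scale: "ext_trace emb (emb c * x) = c * ext_trace emb x"
  by (rule inj_emb[THEN injD]) (simp add: emb_trace emb_mult pow_mult pow_emb sum_distrib_left)

lemma trace_0: "ext_trace emb 0 = 0"
  using trace_add[of 0 0] by (metis add.right_neutral add_cancel_right_right)

lemma trace_sum: "ext_trace emb (\<Sum>i\<in>I. f i) = (\<Sum>i\<in>I. ext_trace emb (f i))"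
  by (induction I rule: infinite_finite_induct) (auto simp: trace_add trace_0)

lemma trace_diff: "ext_trace emb (x - y) = ext_trace emb x - ext_trace emb y"
  using trace_add[of "x - y" y] by simp

lemma trace_pow: "ext_trace emb ((\<sigma> ^^ i) x) = ext_trace emb x"
proof (induction i)
  case (Suc i)
  have "ext_trace emb (\<sigma> y) = ext_trace emb y" for y
  proof -
    have "(\<Sum>j<n. (\<sigma> ^^ j) (\<sigma> y)) + y = (\<Sum>j<Suc n. (\<sigma> ^^ j) y)"
      by (subst sum.lessThan_Suc_shift) (simp add: funpow_Suc_right add.commute del: funpow.simps)
    then show ?thesis
      using sigma_pow_degree by (intro inj_emb[THEN injD]) (simp add: emb_trace)
  qed
  with Suc show ?case by simp
qed simp

text \<open>The trace is the skew polynomial of degree n - 1 with all coefficients 1, hence not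
  identically 0, and a non-zero \<open>z\<close> can be divided out.\<close>

lemma trace_nondegenerate:
  assumes "\<And>y. ext_trace emb (y * z) = 0"
  shows "z = 0"
proof (rule ccontr)
  assume "z \<noteq> 0"
  obtain x where x: "skew (\<lambda>_. 1) (n - 1) x \<noteq> 0"
    using skew_nonzero[of "n - 1" "\<lambda>_. 1"] degree_pos by auto
  have "{..<n} = {..n - 1}"
    using degree_pos by auto
  then have "skew (\<lambda>_. 1) (n - 1) x = emb (ext_trace emb x)"
    by (simp add: skew_def emb_trace)
  also have "\<dots> = 0"
    using assms[of "x / z"] \<open>z \<noteq> 0\<close> by (simp add: emb_0)
  finally show False
    using x by simp
qed

subsection \<open>Trace forms\<close>

lemma trace_form_add: "trace_form emb (b + c) \<tau> = trace_form emb b \<tau> + trace_form emb c \<tau>"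
  by (simp add: trace_form_def fun_eq_iff distrib_right trace_add)

lemma trace_form_scale:
  "trace_form emb (ext_scale emb c b) \<tau> = form_scale c (trace_form emb b \<tau>)"
  by (simp add: trace_form_def fun_eq_iff form_scale_def ext_scale_def mult.assoc trace_scale)

lemma trace_form_0: "trace_form emb 0 \<tau> = 0"
  by (simp add: trace_form_def fun_eq_iff trace_0)

lemma trace_form_sum: "trace_form emb (\<Sum>i\<in>I. f i) \<tau> = (\<Sum>i\<in>I. trace_form emb (f i) \<tau>)"
  by (induction I rule: infinite_finite_induct) (simp_all add: trace_form_add trace_form_0)

sublocale F: vector_space "form_scale :: 'k \<Rightarrow> ('l \<Rightarrow> 'l \<Rightarrow> 'k) \<Rightarrow> _"
  by (rule vector_space_form_scale)

lemma subspace_trace_form_space: "F.subspace (trace_form_space emb \<tau>)"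
proof (rule F.subspaceI)
  show "0 \<in> trace_form_space emb \<tau>"
    unfolding trace_form_space_def using trace_form_0 by (metis (mono_tags, lifting) mem_Collect_eq)
qed (auto simp: trace_form_space_def simp flip: trace_form_add trace_form_scale)

lemma trace_form_in_Alt: "trace_form emb b (\<sigma> ^^ i) \<in> Alt emb"
proof -
  interpret M: vector_space "(*) :: 'k \<Rightarrow> 'k \<Rightarrow> 'k"
    by unfold_locales (auto simp: algebra_simps)
  have lin: "Vector_Spaces.linear (ext_scale emb) (*) g"
    if "\<And>x y. g (x + y) = g x + g y" "\<And>c x. g (ext_scale emb c x) = c * g x" for g
    by unfold_locales (use that in auto)
  have "trace_form emb b (\<sigma> ^^ i) (ext_scale emb c x) y = c * trace_form emb b (\<sigma> ^^ i) x y"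
    "trace_form emb b (\<sigma> ^^ i) x (ext_scale emb c y) = c * trace_form emb b (\<sigma> ^^ i) x y" for c x y
    unfolding trace_form_def trace_scale[symmetric]
    by (simp_all add: ext_scale_def pow_mult pow_emb algebra_simps)
  moreover have
    "trace_form emb b (\<sigma> ^^ i) (x + x') y
       = trace_form emb b (\<sigma> ^^ i) x y + trace_form emb b (\<sigma> ^^ i) x' y"
    "trace_form emb b (\<sigma> ^^ i) y (x + x')
       = trace_form emb b (\<sigma> ^^ i) y x + trace_form emb b (\<sigma> ^^ i) y x'" for x x' y
    unfolding trace_form_def trace_add[symmetric] by (simp_all add: pow_add algebra_simps)
  ultimately show ?thesis
    by (simp add: Alt_def lin trace_form_def[of _ _ _ x x for x] trace_0 mult.commute)
qed

text \<open>
  By invariance of the trace, the form takes the value \<open>Tr (\<sigma>\<^sup>k(y) P(x))\<close> at \<open>(x, y)\<close>,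
  where \<open>P\<close> is the skew polynomial of degree \<open>2k\<close> with coefficient \<open>\<sigma>\<^sup>j(b (k - j))\<close> of \<open>\<sigma>\<^sup>j\<close> for \<open>j < k\<close> and
  \<open>- \<sigma>\<^sup>k(b (j - k))\<close> for \<open>j > k\<close>.
\<close>

lemma dim_radical_sum_trace_forms:
  assumes "i \<in> {1..k}" and "b i \<noteq> 0"
  shows "E.dim (radical (\<Sum>i\<in>{1..k}. trace_form emb (b i) (\<sigma> ^^ i))) \<le> 2 * k"
proof -
  let ?f = "\<Sum>i\<in>{1..k}. trace_form emb (b i) (\<sigma> ^^ i)"
  define a where "a j = (if j < k then (\<sigma> ^^ j) (b (k - j))
    else if j = k then 0 else - (\<sigma> ^^ k) (b (j - k)))" for j
  have skew_a: "skew a (2 * k) x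
      = (\<Sum>i\<in>{1..k}. (\<sigma> ^^ (k - i)) (b i * x) - (\<sigma> ^^ k) (b i) * (\<sigma> ^^ (k + i)) x)" for x
  proof -
    let ?g = "\<lambda>j. a j * (\<sigma> ^^ j) x"
    have a_k: "a k = 0"
      by (simp add: a_def)
    \<comment> \<open>Positions below k stand for i = k - j and those above for i = j - k; position
      k carries the coefficient 0.\<close>
    have "{..2 * k} = {..<k} \<union> {k} \<union> {k + 1..2 * k}"
      by auto
    then have "skew a (2 * k) x = sum ?g ({..<k} \<union> {k} \<union> {k + 1..2 * k})"
      by (simp add: skew_def)
    also have "\<dots> = sum ?g {..<k} + ?g k + sum ?g {k + 1..2 * k}"
      by (subst sum.union_disjoint; auto)+
    also have "sum ?g {..<k} = (\<Sum>i\<in>{1..k}. (\<sigma> ^^ (k - i)) (b i * x))"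
      by (rule sum.reindex_bij_witness[of _ "\<lambda>i. k - i" "\<lambda>i. k - i"]) (auto simp: a_def pow_mult)
    also have "sum ?g {k + 1..2 * k} = (\<Sum>i\<in>{1..k}. - ((\<sigma> ^^ k) (b i) * (\<sigma> ^^ (k + i)) x))"
      by (rule sum.reindex_bij_witness[of _ "\<lambda>i. k + i" "\<lambda>i. i - k"]) (auto simp: a_def)
    finally show ?thesis
      using a_k by (simp add: sum_subtractf sum_negf)
  qed
  have f_eq: "?f x y = ext_trace emb ((\<sigma> ^^ k) y * skew a (2 * k) x)" for x y
  proof -
    \<comment> \<open>Apply \<open>\<sigma> ^^ (k - i)\<close> to the first half of the argument of
      the trace and \<open>\<sigma> ^^ k\<close> to the second; this makes
      \<open>(\<sigma> ^^ k) y\<close> a common factor.\<close>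
    have "trace_form emb (b i) (\<sigma> ^^ i) x y = ext_trace emb ((\<sigma> ^^ k) y *
        ((\<sigma> ^^ (k - i)) (b i * x) - (\<sigma> ^^ k) (b i) * (\<sigma> ^^ (k + i)) x))" if "i \<in> {1..k}" for i
    proof -
      have "(\<sigma> ^^ (k - i)) ((\<sigma> ^^ i) y) = (\<sigma> ^^ k) y"
        using that by (metis atLeastAtMost_iff comp_apply funpow_add le_add_diff_inverse2)
      then have "(\<sigma> ^^ k) y * (\<sigma> ^^ (k - i)) (b i * x) = (\<sigma> ^^ (k - i)) (b i * x * (\<sigma> ^^ i) y)"
        by (simp add: pow_mult)
      moreover have "(\<sigma> ^^ k) y * ((\<sigma> ^^ k) (b i) * (\<sigma> ^^ (k + i)) x)
          = (\<sigma> ^^ k) (b i * (\<sigma> ^^ i) x * y)"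
        by (simp add: pow_mult funpow_add)
      ultimately show ?thesis
        by (simp add: right_diff_distrib trace_diff trace_pow trace_form_def mult.assoc)
    qed
    then show ?thesis
      by (simp add: sum_apply skew_a sum_distrib_left trace_sum)
  qed
  have ker: "skew a (2 * k) x = 0" if "x \<in> radical ?f" for x
  proof (rule trace_nondegenerate)
    fix y
    \<comment> \<open>As \<open>\<sigma> ^^ k\<close> is surjective, the common factor ranges over
      all of L.\<close>
    obtain z where "y = (\<sigma> ^^ k) z"
      using pow_bij[of k] by (metis bij_pointE)
    then show "ext_trace emb (y * skew a (2 * k) x) = 0"
      using that f_eq[of x z] by (simp add: radical_def)
  qed
  have "a (k + i) \<noteq> 0" "k + i \<le> 2 * k"
    using assms by (auto simp: a_def pow_eq_0_iff)
  then have nonzero: "\<exists>j\<le>2 * k. a j \<noteq> 0"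
    by blast
  obtain R where R: "R \<subseteq> radical ?f" "E.independent R" "radical ?f \<subseteq> E.span R"
    "card R = E.dim (radical ?f)"
    by (rule E.basis_exists)
  have "card R \<le> 2 * k"
    using R(1) ker by (intro card_independent_skew_kernel[OF R(2) _ nonzero]) blast
  then show ?thesis
    using R(4) by simp
qed

text \<open>The zero form has radical L, of dimension n > 2k, which the radical bound excludes once
  some coefficient is non-zero.\<close>

lemma sum_trace_forms_eq_0:
  assumes "2 * k < n" and "(\<Sum>i\<in>{1..k}. trace_form emb (b i) (\<sigma> ^^ i)) = 0" and "i \<in> {1..k}"
  shows "b i = 0"
proof (rule ccontr)
  assume "b i \<noteq> 0"
  then have "E.dim (radical (0 :: 'l \<Rightarrow> 'l \<Rightarrow> 'k)) \<le> 2 * k"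
    using dim_radical_sum_trace_forms[of i k b] assms by simp
  moreover have "radical (0 :: 'l \<Rightarrow> 'l \<Rightarrow> 'k) = UNIV"
    by (simp add: radical_def)
  ultimately show False
    using assms by (simp add: ext_degree_def)
qed

text \<open>The forms indexed by pairs (i, v), with v from a basis of L, are a basis of the
  sum.\<close>

lemma dim_family_sum_trace_form_spaces:
  assumes "2 * k < n"
  shows "F.dim (family_sum {1..k} (\<lambda>i. trace_form_space emb (\<sigma> ^^ i))) = n * k"
proof -
  let ?V = "family_sum {1..k} (\<lambda>i. trace_form_space emb (\<sigma> ^^ i))"
  obtain B where B: "finite B" "card B = n" "E.independent B" "E.span B = UNIV"
    by (rule basis_exists_degree)
  define g where "g p = trace_form emb (snd p) (\<sigma> ^^ fst p)" for p :: "nat \<times> 'l"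
  define I where "I = {1..k} \<times> B"
  have fin: "finite I"
    using B by (simp add: I_def)
  have zero: "\<forall>p\<in>I. c p = 0" if "(\<Sum>p\<in>I. form_scale (c p) (g p)) = 0" for c
  proof -
    \<comment> \<open>Linearity in the coefficient merges the relation into one trace form for each
      i.\<close>
    have "(\<Sum>i\<in>{1..k}. trace_form emb (\<Sum>v\<in>B. ext_scale emb (c (i, v)) v) (\<sigma> ^^ i)) = 0"
      using that
      by (simp add: I_def g_def trace_form_sum trace_form_scale sum.cartesian_product case_prod_unfold)
    then have "(\<Sum>v\<in>B. ext_scale emb (c (i, v)) v) = 0" if "i \<in> {1..k}" for i
      using sum_trace_forms_eq_0[OF assms, of "\<lambda>i. \<Sum>v\<in>B. ext_scale emb (c (i, v)) v"] that by blast
    then show ?thesis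
      using E.independentD[OF B(3,1) order_refl] by (fastforce simp: I_def)
  qed
  have "F.span (g ` I) = ?V"
  proof
    \<comment> \<open>Padding with the coefficient 0 at the other indices puts a single form into
      the sum.\<close>
    have "trace_form emb v (\<sigma> ^^ i) \<in> ?V" if "i \<in> {1..k}" for i v
      unfolding family_sum_def using that
      by (auto intro!: exI[of _ "\<lambda>j. trace_form emb (if j = i then v else 0) (\<sigma> ^^ j)"]
          simp: trace_form_space_def if_distrib[of "\<lambda>b. trace_form emb b _"] trace_form_0 cong: if_cong)
    then show "F.span (g ` I) \<subseteq> ?V"
      by (intro F.span_minimal F.subspace_family_sum subspace_trace_form_space)
        (auto simp: g_def I_def)
    have "trace_form emb b (\<sigma> ^^ i) \<in> F.span (g ` I)" if i: "i \<in> {1..k}" for i b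
    proof -
      have "b \<in> E.span B" using B by simp
      then show ?thesis
      proof (induction rule: E.span_induct_alt)
        case base
        show ?case unfolding trace_form_0 by (rule F.span_zero)
      next
        case (step c v y)
        then have "trace_form emb v (\<sigma> ^^ i) \<in> g ` I"
          using i by (force simp: g_def I_def)
        with step show ?case
          unfolding trace_form_add trace_form_scale
          by (blast intro: F.span_add F.span_scale F.span_base)
      qed
    qed
    then show "?V \<subseteq> F.span (g ` I)"
      unfolding family_sum_def trace_form_space_def by (auto intro!: F.span_sum)
  qed
  moreover have "F.independent (g ` I)"
    using F.independent_family(2)[OF fin, of g] zero by blast
  ultimately have "F.dim ?V = card (g ` I)"
    using F.dim_span_eq_card_independent by metis
  also have "\<dots> = n * k"
    using card_image[of g I] F.independent_family(1)[OF fin, of g] zero B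
    by (simp add: I_def mult.commute)
  finally show ?thesis .
qed

end

section \<open>Directness, dimension and rank bound in degree 2m + 2\<close>

theorem theorem7:
  fixes emb :: "'k::field \<Rightarrow> 'l::field"
    and \<sigma> :: "'l \<Rightarrow> 'l"
    and A :: "nat \<Rightarrow> ('l \<Rightarrow> 'l \<Rightarrow> 'k) set"
    and n m k :: nat
  assumes "finite_galois emb"
    and "ext_degree emb = n"
    and "n = 2 * m + 2"
    and "\<sigma> \<in> carrier (galois_group emb)"
    and "carrier (galois_group emb) = generate (galois_group emb) {\<sigma>}"
    and "\<And>i. 1 \<le> i \<Longrightarrow> i \<le> m + 1 \<Longrightarrow> A i = trace_form_space emb (\<sigma> ^^ i)"
    and "1 \<le> k" and "k \<le> m"
  shows "(\<forall>i\<in>{1..m + 1}. A i \<subseteq> Alt emb \<and> module.subspace form_scale (A i)) \<and>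
    sum_is_direct {1..k} A \<and>
    family_sum {1..k} A \<subseteq> Alt emb \<and>
    module.subspace form_scale (family_sum {1..k} A) \<and>
    vector_space.dim form_scale (family_sum {1..k} A) = n * k \<and>
    (\<forall>f\<in>family_sum {1..k} A. f \<noteq> 0 \<longrightarrow> n - 2 * k \<le> form_rank emb f)"
proof -
  have "field_extension emb"
    using assms(1) by (simp add: finite_galois_def)
  then interpret field_extension emb .
  interpret C: cyclic_galois_extension emb \<sigma>
    by unfold_locales (use assms in auto)
  let ?T = "\<lambda>i. trace_form_space emb (\<sigma> ^^ i)"
  have A: "A i = ?T i" if "i \<in> {1..k}" for i
    using that assms by simp
  \<comment> \<open>The bound k \<le> m enters here: 2k \<le> 2m = n - 2.\<close>
  have small: "2 * k < ext_degree emb"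
    using assms by simp
  have T_Alt: "?T i \<subseteq> Alt emb" for i
    using C.trace_form_in_Alt by (auto simp: trace_form_space_def)
  have A_forms: "\<exists>b. \<forall>i\<in>{1..k}. g i = trace_form emb (b i) (\<sigma> ^^ i)"
    if "\<forall>i\<in>{1..k}. g i \<in> A i" for g
  proof (rule bchoice)
    show "\<forall>i\<in>{1..k}. \<exists>b. g i = trace_form emb b (\<sigma> ^^ i)"
      using that A by (fastforce simp: trace_form_space_def)
  qed
  have fam: "family_sum {1..k} A = family_sum {1..k} ?T"
    using A by (simp add: family_sum_def)
  have direct: "sum_is_direct {1..k} A"
    unfolding sum_is_direct_def
  proof (intro allI impI)
    fix g assume g: "(\<forall>i\<in>{1..k}. g i \<in> A i) \<and> (\<Sum>i\<in>{1..k}. g i) = 0"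
    then obtain b where b: "\<forall>i\<in>{1..k}. g i = trace_form emb (b i) (\<sigma> ^^ i)"
      using A_forms by blast
    with g have "(\<Sum>i\<in>{1..k}. trace_form emb (b i) (\<sigma> ^^ i)) = 0"
      by simp
    then show "\<forall>i\<in>{1..k}. g i = 0"
      using C.sum_trace_forms_eq_0[OF small] b by (metis C.trace_form_0)
  qed
  have rank: "n - 2 * k \<le> form_rank emb f" if f: "f \<in> family_sum {1..k} A" "f \<noteq> 0" for f
  proof -
    obtain g where g: "f = sum g {1..k}" "\<forall>i\<in>{1..k}. g i \<in> A i"
      using f(1) unfolding family_sum_def by blast
    then obtain b where b: "\<forall>i\<in>{1..k}. g i = trace_form emb (b i) (\<sigma> ^^ i)"
      using A_forms by blast
    with g have f_eq: "f = (\<Sum>i\<in>{1..k}. trace_form emb (b i) (\<sigma> ^^ i))"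
      by simp
    then obtain i where "i \<in> {1..k}" "b i \<noteq> 0"
      using f(2) C.trace_form_0 by (metis (no_types, lifting) sum.neutral)
    then have "C.E.dim (radical f) \<le> 2 * k"
      unfolding f_eq by (rule C.dim_radical_sum_trace_forms)
    then show ?thesis
      using assms(2) by (simp add: form_rank_def)
  qed
  have sub: "C.F.subspace (family_sum {1..k} ?T)"
    by (intro C.F.subspace_family_sum C.subspace_trace_form_space)
  have "family_sum {1..k} ?T \<subseteq> Alt emb"
    unfolding family_sum_def using T_Alt by (auto intro!: C.F.subspace_sum[OF subspace_Alt])
  moreover have "\<forall>i\<in>{1..m + 1}. A i \<subseteq> Alt emb \<and> C.F.subspace (A i)"
    using assms(6) T_Alt C.subspace_trace_form_space by simp
  moreover have "C.F.dim (family_sum {1..k} ?T) = n * k"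
    using C.dim_family_sum_trace_form_spaces[OF small] assms(2) by simp
  ultimately show ?thesis
    using direct rank sub unfolding fam by blast
qed

end
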